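(* Let $n\ge 1$, let $\bm{a}_1,\ldots,\bm{a}_m\in\mathbb{R}^n$ be such that $\{\bm{a}_i-\bm{a}_1\}_{i=2}^m$ spans $\mathbb{R}^n$, let $\bm{x}^\star\in\mathbb{R}^n$, and let $c_0>0$ be a constant. Then there exist constants $K_1,K_2>0$, determined by $\bm{a}_1,\ldots,\bm{a}_m$ and $\bm{x}^\star$ (and the fixed constant $c_0$), such that the following holds. Let $\sigma\ge 0$ and let $\bm{w}=(w_1,\ldots,w_m)$ be a realization of measurement noise (with noise level $\sigma$, as described in the context, in particular $|w_i|\le \frac12\|\bm{x}^\star-\bm{a}_i\|$ for all $i$) satisfying $\|\bm{w}\|\le c_0\sqrt{m}\,\sigma$. Let $r_i=\|\bm{x}^\star-\bm{a}_i\|+w_i$ for $i=1,\ldots,m$, and let $\hat{\bm{x}}$ be any global minimizer over $\mathbb{R}^n$ of $f(\bm{x})=\sum_{i=1}^m(\|\bm{x}-\bm{a}_i\|-r_i)^2$. Then $$\|\hat{\bm{x}}-\bm{x}^\star\|\le K_1\sqrt{m}\,\sigma+K_2\,m\,\sigma^2 .$$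
   Context: $\|\cdot\|$ is the Euclidean norm. Noise model: $w_1,\ldots,w_m$ are independent real random variables with mean zero and variance at most $\sigma^2$, and each $|w_i|$ is small compared with $\|\bm{x}^\star-\bm{a}_i\|$, which is made precise here as $|w_i|\le \frac12\|\bm{x}^\star-\bm{a}_i\|$. The statement is about a fixed realization of $\bm{w}$ (i.e. it holds for every outcome for which the stated bounds on $|w_i|$ and $\|\bm{w}\|$ hold); the constants $K_1,K_2$ do not depend on $\sigma$ or on the realization. Here $\bm{x}^\star$ is the true target position, $\bm{a}_i$ are the sensor positions, $r_i$ are the noisy time-of-arrival range measurements, and $\hat{\bm{x}}$ is a least-squares estimate of $\bm{x}^\star$. *)

theory Defs
  imports "HOL-Probability.Probability"
begin

text \<open>
  The noise vector is described by its joint law \<open>N\<close> on the product space of functions on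
  \<open>{1..m}\<close>, the noise variables being the coordinate maps.  This loses no generality: random
  variables \<open>W\<^sub>1, \<dots>, W\<^sub>m\<close> on an arbitrary probability space have such a law, and each of their
  realizations is a point of its \<open>space\<close>.  Working with laws keeps the type of the sample space
  out of the statement, so that constants chosen before \<open>N\<close> cannot depend on it.
  Integrability is assumed explicitly, because Bochner integrals of non-integrable functions are \<open>0\<close>.
\<close>

locale measurement_noise = prob_space N
  for N :: "(nat \<Rightarrow> real) measure" and m :: nat and \<sigma> :: real +
  assumes sets_noise: "sets N = sets (PiM {1..m} (\<lambda>_. borel))"
    and indep_noise: "indep_vars (\<lambda>_. borel) (\<lambda>i w. w i) {1..m}"
    and integrable_noise: "\<And>i. i \<in> {1..m} \<Longrightarrow> integrable N (\<lambda>w. w i)"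
    and integrable_square_noise: "\<And>i. i \<in> {1..m} \<Longrightarrow> integrable N (\<lambda>w. (w i)\<^sup>2)"
    and mean_noise: "\<And>i. i \<in> {1..m} \<Longrightarrow> expectation (\<lambda>w. w i) = 0"
    and variance_noise: "\<And>i. i \<in> {1..m} \<Longrightarrow> variance (\<lambda>w. w i) \<le> \<sigma>\<^sup>2"

definition noisy_range ::
    "(nat \<Rightarrow> 'a::real_normed_vector) \<Rightarrow> 'a \<Rightarrow> (nat \<Rightarrow> real) \<Rightarrow> nat \<Rightarrow> real" where
  "noisy_range a xs w i = norm (xs - a i) + w i"

definition range_ls_objective ::
    "nat \<Rightarrow> (nat \<Rightarrow> 'a::real_normed_vector) \<Rightarrow> (nat \<Rightarrow> real) \<Rightarrow> 'a \<Rightarrow> real" where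
  "range_ls_objective m a r x = (\<Sum>i=1..m. (norm (x - a i) - r i)\<^sup>2)"

end

theory Submission
  imports Defs
begin

text \<open>
  Write \<open>v = xhat - xs\<close> for the error and \<open>\<delta>\<^sub>i\<close> for the change in the distance to \<open>a\<^sub>i\<close> when \<open>xs\<close> is
  replaced by \<open>xhat\<close>. The residuals of the least-squares problem are \<open>-w\<close> at \<open>xs\<close> and \<open>\<delta> - w\<close> at
  \<open>xhat\<close>, so minimality and the triangle inequality give \<open>\<parallel>\<delta>\<parallel> \<le> 2 \<parallel>w\<parallel>\<close>
  (\<open>range_ls_minimizer_distance_change\<close>). Distances thus move little.

  To turn this into a bound on \<open>v\<close>, square the distances: the difference of two squared distances
  is affine in the position, so subtracting the equation of sensor \<open>1\<close> from that of sensor \<open>i\<close>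
  expresses \<open>v \<bullet> (a\<^sub>i - a\<^sub>1)\<close> through \<open>\<delta>\<^sub>i\<close> and \<open>\<delta>\<^sub>1\<close>. If all distances from \<open>xs\<close> are at most \<open>D\<close> and
  \<open>\<bar>\<delta>\<^sub>i\<bar> \<le> t\<close>, this inner product is at most \<open>t (2 D + t)\<close> (\<open>inner_le_of_distance_change\<close>).
  Since the vectors \<open>a\<^sub>i - a\<^sub>1\<close> span, a bound on these inner products bounds \<open>v\<close> itself
  (\<open>spanning_inner_bound\<close>). With \<open>t = 2 c\<^sub>0 \<surd>m \<sigma>\<close> the term \<open>2 D t\<close> becomes the linear and \<open>t\<^sup>2\<close> the
  quadratic term of the claimed estimate.
\<close>

text \<open>
  The vectors \<open>x\<close> for which \<open>\<bar>v \<bullet> x\<bar>\<close> is controlled by a multiple of the bound on \<open>S\<close>, uniformly in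
  \<open>v\<close>, form a subspace containing \<open>S\<close>. Hence every basis vector is one of them.
\<close>

lemma spanning_inner_bound:
  fixes S :: "'a::euclidean_space set"
  assumes "span S = UNIV"
  obtains C where "C > 0"
    and "\<And>v e. 0 \<le> e \<Longrightarrow> (\<And>s. s \<in> S \<Longrightarrow> \<bar>v \<bullet> s\<bar> \<le> e) \<Longrightarrow> norm v \<le> C * e"
proof -
  define P where
    "P x M \<longleftrightarrow> (\<forall>v e. 0 \<le> e \<longrightarrow> (\<forall>s\<in>S. \<bar>v \<bullet> s\<bar> \<le> e) \<longrightarrow> \<bar>v \<bullet> x\<bar> \<le> M * e)" for x :: 'a and M :: real
  have "\<exists>M. P x M" for x
  proof -
    have "x \<in> span S" using assms by simp
    then show ?thesis
    proof (induction rule: span_induct_alt)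
      case base
      show ?case by (intro exI[of _ 0]) (simp add: P_def)
    next
      case (step c s y)
      then obtain M where M: "P y M" by blast
      have "P (c *\<^sub>R s + y) (\<bar>c\<bar> + M)"
        unfolding P_def
      proof (intro allI impI)
        fix v e assume e: "0 \<le> e" and v: "\<forall>s\<in>S. \<bar>v \<bullet> s\<bar> \<le> e"
        have "\<bar>v \<bullet> (c *\<^sub>R s + y)\<bar> \<le> \<bar>c\<bar> * \<bar>v \<bullet> s\<bar> + \<bar>v \<bullet> y\<bar>"
          by (metis abs_mult abs_triangle_ineq inner_add_right inner_scaleR_right)
        also have "\<dots> \<le> \<bar>c\<bar> * e + M * e"
          using M e v step.hyps by (intro add_mono mult_left_mono) (auto simp: P_def)
        finally show "\<bar>v \<bullet> (c *\<^sub>R s + y)\<bar> \<le> (\<bar>c\<bar> + M) * e" by (simp add: algebra_simps)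
      qed
      then show ?case by blast
    qed
  qed
  then obtain M where M: "\<And>x. P x (M x)" by metis
  define C where "C = \<bar>\<Sum>b\<in>Basis. M b\<bar> + 1"
  show thesis
  proof (rule that)
    show "C > 0" by (simp add: C_def)
    fix v :: 'a and e :: real
    assume e: "0 \<le> e" and v: "\<And>s. s \<in> S \<Longrightarrow> \<bar>v \<bullet> s\<bar> \<le> e"
    have "norm v \<le> (\<Sum>b\<in>Basis. \<bar>v \<bullet> b\<bar>)" by (rule norm_le_l1)
    also have "\<dots> \<le> (\<Sum>b\<in>Basis. M b * e)"
      using M e v by (intro sum_mono) (auto simp: P_def)
    also have "\<dots> \<le> C * e"
      unfolding sum_distrib_right[symmetric] C_def using e by (intro mult_right_mono) auto
    finally show "norm v \<le> C * e" .
  qed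
qed

lemma range_ls_minimizer_distance_change:
  fixes a :: "nat \<Rightarrow> 'a::real_normed_vector"
  assumes "is_arg_min (range_ls_objective m a (noisy_range a xs w)) (\<lambda>_. True) xhat"
  shows "L2_set (\<lambda>i. norm (xhat - a i) - norm (xs - a i)) {1..m} \<le> 2 * L2_set w {1..m}"
proof -
  let ?\<delta> = "\<lambda>i. norm (xhat - a i) - norm (xs - a i)"
  have "(\<Sum>i=1..m. (?\<delta> i - w i)\<^sup>2) \<le> (\<Sum>i=1..m. (w i)\<^sup>2)"
    using assms
    by (auto simp: is_arg_min_linorder range_ls_objective_def noisy_range_def algebra_simps
        dest: spec[of _ xs])
  then have "L2_set (\<lambda>i. ?\<delta> i - w i) {1..m} \<le> L2_set w {1..m}"
    by (simp add: L2_set_def)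
  moreover have "L2_set ?\<delta> {1..m} \<le> L2_set (\<lambda>i. ?\<delta> i - w i) {1..m} + L2_set w {1..m}"
    using L2_set_triangle_ineq[of "\<lambda>i. ?\<delta> i - w i" w "{1..m}"] by simp
  ultimately show ?thesis by simp
qed

text \<open>
  The terms \<open>\<parallel>x\<parallel>\<^sup>2\<close> and \<open>\<parallel>y\<parallel>\<^sup>2\<close> cancel when the squared distances to \<open>p\<close> and \<open>q\<close> are compared, so that
  only the inner product with \<open>p - q\<close> remains.
\<close>

lemma inner_le_of_distance_change:
  fixes x y p q :: "'a::real_inner"
  assumes "norm (y - p) \<le> D" "norm (y - q) \<le> D"
    and "\<bar>norm (x - p) - norm (y - p)\<bar> \<le> t" "\<bar>norm (x - q) - norm (y - q)\<bar> \<le> t"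
  shows "\<bar>(x - y) \<bullet> (p - q)\<bar> \<le> t * (2 * D + t)"
proof -
  have square_change: "\<bar>(norm (x - z))\<^sup>2 - (norm (y - z))\<^sup>2\<bar> \<le> t * (2 * D + t)"
    if "norm (y - z) \<le> D" "\<bar>norm (x - z) - norm (y - z)\<bar> \<le> t" for z
  proof -
    have "(norm (x - z))\<^sup>2 - (norm (y - z))\<^sup>2
        = (norm (x - z) - norm (y - z)) * (norm (x - z) + norm (y - z))"
      by (simp add: power2_eq_square algebra_simps)
    then show ?thesis using that
      by (auto simp: abs_mult intro!: mult_mono)
  qed
  have "2 * ((x - y) \<bullet> (p - q)) = ((norm (x - q))\<^sup>2 - (norm (y - q))\<^sup>2)
      - ((norm (x - p))\<^sup>2 - (norm (y - p))\<^sup>2)"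
    by (simp add: power2_norm_eq_inner inner_diff_left inner_diff_right inner_commute)
  then show ?thesis
    using square_change[OF assms(1,3)] square_change[OF assms(2,4)] by linarith
qed

theorem proposition1:
  fixes m :: nat and a :: "nat \<Rightarrow> real ^ 'n" and xs :: "real ^ 'n" and c0 :: real
  assumes "span ((\<lambda>i. a i - a 1) ` {2..m}) = UNIV"
    and "c0 > 0"
  shows "\<exists>K1>0. \<exists>K2>0. \<forall>\<sigma>\<ge>0. \<forall>N. measurement_noise N m \<sigma> \<longrightarrow>
    (\<forall>w\<in>space N. (\<forall>i\<in>{1..m}. \<bar>w i\<bar> \<le> 1 / 2 * norm (xs - a i)) \<and>
        L2_set w {1..m} \<le> c0 * sqrt (real m) * \<sigma> \<longrightarrow>
      (\<forall>xhat. is_arg_min (range_ls_objective m a (noisy_range a xs w)) (\<lambda>_. True) xhat \<longrightarrow>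
        norm (xhat - xs) \<le> K1 * sqrt (real m) * \<sigma> + K2 * real m * \<sigma>\<^sup>2))"
proof -
  obtain C where C: "C > 0"
    and inner_bound: "\<And>v e. 0 \<le> e \<Longrightarrow> (\<And>s. s \<in> (\<lambda>i. a i - a 1) ` {2..m} \<Longrightarrow> \<bar>v \<bullet> s\<bar> \<le> e)
      \<Longrightarrow> norm v \<le> C * e"
    using spanning_inner_bound[OF assms(1)] by metis
  define D where "D = L2_set (\<lambda>i. norm (xs - a i)) {1..m}"
  have D: "norm (xs - a i) \<le> D" if "i \<in> {1..m}" for i
    using member_le_L2_set[of "{1..m}" i "\<lambda>i. norm (xs - a i)"] that by (simp add: D_def)
  have "D \<ge> 0" by (simp add: D_def)
  have error_bound: "norm (xhat - xs)
      \<le> (C * (4 * D * c0) + 1) * sqrt (real m) * \<sigma> + C * (4 * c0\<^sup>2) * real m * \<sigma>\<^sup>2"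
    if "\<sigma> \<ge> 0" and w: "L2_set w {1..m} \<le> c0 * sqrt (real m) * \<sigma>"
      and xhat: "is_arg_min (range_ls_objective m a (noisy_range a xs w)) (\<lambda>_. True) xhat"
    for \<sigma> w xhat
  proof -
    define t where "t = 2 * (c0 * sqrt (real m) * \<sigma>)"
    have "t \<ge> 0" using \<open>c0 > 0\<close> \<open>\<sigma> \<ge> 0\<close> by (simp add: t_def)
    have change: "\<bar>norm (xhat - a i) - norm (xs - a i)\<bar> \<le> t" if "i \<in> {1..m}" for i
    proof -
      let ?\<delta> = "\<lambda>i. norm (xhat - a i) - norm (xs - a i)"
      have "\<bar>?\<delta> i\<bar> \<le> L2_set (\<lambda>i. \<bar>?\<delta> i\<bar>) {1..m}"
        using that by (intro member_le_L2_set) auto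
      also have "\<dots> = L2_set ?\<delta> {1..m}" by (simp add: L2_set_def)
      finally show ?thesis
        using range_ls_minimizer_distance_change[OF xhat] w unfolding t_def by linarith
    qed
    have "norm (xhat - xs) \<le> C * (t * (2 * D + t))"
    proof (rule inner_bound)
      show "0 \<le> t * (2 * D + t)" using \<open>t \<ge> 0\<close> \<open>D \<ge> 0\<close> by simp
      fix s assume "s \<in> (\<lambda>i. a i - a 1) ` {2..m}"
      then obtain i where "i \<in> {2..m}" and s: "s = a i - a 1" by blast
      then have "i \<in> {1..m}" "1 \<in> {1..m}" by auto
      then show "\<bar>(xhat - xs) \<bullet> s\<bar> \<le> t * (2 * D + t)"
        unfolding s by (intro inner_le_of_distance_change D change)
    qed
    also have "\<dots> = C * (4 * D * c0) * sqrt (real m) * \<sigma> + C * (4 * c0\<^sup>2) * (sqrt (real m))\<^sup>2 * \<sigma>\<^sup>2"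
      by (simp add: t_def power2_eq_square algebra_simps)
    also have "\<dots> \<le> (C * (4 * D * c0) + 1) * sqrt (real m) * \<sigma> + C * (4 * c0\<^sup>2) * real m * \<sigma>\<^sup>2"
      using \<open>\<sigma> \<ge> 0\<close> by (simp add: algebra_simps)
    finally show ?thesis .
  qed
  \<comment> \<open>The summand \<open>1\<close> makes the first constant positive whatever \<open>D \<ge> 0\<close> is.\<close>
  have "C * (4 * D * c0) + 1 > 0" "C * (4 * c0\<^sup>2) > 0"
    using C \<open>D \<ge> 0\<close> \<open>c0 > 0\<close> by (auto intro: add_nonneg_pos)
  then show ?thesis using error_bound by blast
qed

end
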